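(* Let $p^{a}_{1:K}=(p^a_1,\dots,p^a_K)\in[0,1]^K$ be the automation's posterior beliefs and let $w\in\mathcal{W}$ be a given task load. Consider the problem of minimizing $$J(\mathcal{N},\{D_k\}_{k\in\mathcal{K}\setminus\mathcal{N}},p^{a}_{1:K})=\sum_{k\in\mathcal{K}\setminus\mathcal{N}}\Gamma^{a}(p^{a}_k,D_k)+\sum_{n\in\mathcal{N}}\Gamma^{h}(p^{a}_n,|\mathcal{N}|)$$ over all subsets $\mathcal{N}\subseteq\mathcal{K}$ with $|\mathcal{N}|=w$ and all decisions $D_k\in\{\mathcal{H}_0,\mathcal{H}_1\}$, $k\in\mathcal{K}\setminus\mathcal{N}$. Then it is optimal to take $\mathcal{N}$ to be a set of $w$ tasks with the largest referral indices among $\{R(p^{a}_k,w)\}_{k=1}^K$ (ties broken arbitrarily), and for each $k\in\mathcal{K}\setminus\mathcal{N}$ to take $D_k=\mathcal{H}_0$ if $\Gamma^{a}(p^{a}_k,\mathcal{H}_0)\le\Gamma^{a}(p^{a}_k,\mathcal{H}_1)$ and $D_k=\mathcal{H}_1$ otherwise.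
   Context: Setting: $K\ge 1$ is an integer, $\mathcal{K}=\{1,\dots,K\}$ indexes a batch of binary classification tasks, and $\{\mathcal{H}_0,\mathcal{H}_1\}$ is a two-element set of hypotheses. $\mathcal{W}\subseteq\{0,1,\dots,K\}$ is the set of possible task loads. An automation holds, for each task $k$, a posterior belief $p^a_k\in[0,1]$ (the conditional probability, given the automation's observation of task $k$, that the true state of task $k$ is $\mathcal{H}_1$). It refers a subset $\mathcal{N}\subseteq\mathcal{K}$ of the tasks to a human operator and makes a terminal decision $D_k\in\{\mathcal{H}_0,\mathcal{H}_1\}$ for each task $k\in\mathcal{K}\setminus\mathcal{N}$. The task load is $|\mathcal{N}|$. Data: real decision costs $C(D,H)$ for $D,H\in\{\mathcal{H}_0,\mathcal{H}_1\}$, where $D$ is the decision and $H$ the true state, abbreviated $c_{tp}=C(\mathcal{H}_1,\mathcal{H}_1)$, $c_{fp}=C(\mathcal{H}_1,\mathcal{H}_0)$, $c_{tn}=C(\mathcal{H}_0,\mathcal{H}_0)$, $c_{fn}=C(\mathcal{H}_0,\mathcal{H}_1)$; a real referral cost $c_r$; and arbitrary functions $P^{h}_{tp},P^{h}_{fp}:\mathcal{W}\to[0,1]$ (the human operator's true positive and false positive rates as functions of task load). Definitions, for $p\in[0,1]$, $D\in\{\mathcal{H}_0,\mathcal{H}_1\}$ and $w\in\mathcal{W}$: $$\Gamma^{a}(p,D)=(1-p)\,C(D,\mathcal{H}_0)+p\,C(D,\mathcal{H}_1),$$ $$\Gamma^{a}_*(p)=\min\{\Gamma^{a}(p,\mathcal{H}_0),\Gamma^{a}(p,\mathcal{H}_1)\},$$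 $$\Gamma^{h}(p,w)=c_r+(1-p)\left[P^{h}_{fp}(w)c_{fp}+(1-P^{h}_{fp}(w))c_{tn}\right]+p\left[P^{h}_{tp}(w)c_{tp}+(1-P^{h}_{tp}(w))c_{fn}\right].$$ The referral index is $R(p,w)=\Gamma^{a}_*(p)-\Gamma^{h}(p,w)$. *)

theory Defs
  imports Complex_Main "HOL-Library.FuncSet"
begin

datatype hypothesis = H0 | H1

text \<open>In \<open>C D H\<close> the first argument is the decision and the second the true state, so that
  \<open>C H1 H1\<close>, \<open>C H1 H0\<close>, \<open>C H0 H0\<close>, \<open>C H0 H1\<close> are the costs \<open>c_tp\<close>, \<open>c_fp\<close>, \<open>c_tn\<close>, \<open>c_fn\<close>.\<close>

type_synonym costs = "hypothesis \<Rightarrow> hypothesis \<Rightarrow> real"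

definition Gamma_a :: "costs \<Rightarrow> real \<Rightarrow> hypothesis \<Rightarrow> real" where
  "Gamma_a C p D = (1 - p) * C D H0 + p * C D H1"

definition Gamma_a_star :: "costs \<Rightarrow> real \<Rightarrow> real" where
  "Gamma_a_star C p = min (Gamma_a C p H0) (Gamma_a C p H1)"

text \<open>\<open>Ptp\<close> and \<open>Pfp\<close> are the operator's true and false positive rates as functions of the task
  load; only their values on the set of possible task loads matter.\<close>

definition Gamma_h ::
  "costs \<Rightarrow> real \<Rightarrow> (nat \<Rightarrow> real) \<Rightarrow> (nat \<Rightarrow> real) \<Rightarrow> real \<Rightarrow> nat \<Rightarrow> real" where
  "Gamma_h C cr Ptp Pfp p w =
     cr + (1 - p) * (Pfp w * C H1 H0 + (1 - Pfp w) * C H0 H0)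
        + p * (Ptp w * C H1 H1 + (1 - Ptp w) * C H0 H1)"

definition referral_index ::
  "costs \<Rightarrow> real \<Rightarrow> (nat \<Rightarrow> real) \<Rightarrow> (nat \<Rightarrow> real) \<Rightarrow> real \<Rightarrow> nat \<Rightarrow> real" where
  "referral_index C cr Ptp Pfp p w = Gamma_a_star C p - Gamma_h C cr Ptp Pfp p w"

text \<open>The decisions are a total function \<open>D\<close>, of which only the values on \<open>{1..K} - N\<close> enter.\<close>

definition total_cost ::
  "costs \<Rightarrow> real \<Rightarrow> (nat \<Rightarrow> real) \<Rightarrow> (nat \<Rightarrow> real) \<Rightarrow> nat \<Rightarrow>
   nat set \<Rightarrow> (nat \<Rightarrow> hypothesis) \<Rightarrow> (nat \<Rightarrow> real) \<Rightarrow> real" where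
  "total_cost C cr Ptp Pfp K N D p =
     (\<Sum>k\<in>{1..K} - N. Gamma_a C (p k) (D k)) +
     (\<Sum>n\<in>N. Gamma_h C cr Ptp Pfp (p n) (card N))"

text \<open>\<open>N\<close> consists of \<open>w\<close> elements of \<open>A\<close> with the largest values of \<open>f\<close>; when there are ties,
  several sets \<open>N\<close> qualify.\<close>

definition is_top_set :: "('a \<Rightarrow> real) \<Rightarrow> 'a set \<Rightarrow> nat \<Rightarrow> 'a set \<Rightarrow> bool" where
  "is_top_set f A w N \<longleftrightarrow>
     N \<subseteq> A \<and> card N = w \<and> (\<forall>i\<in>N. \<forall>j\<in>A - N. f j \<le> f i)"

end

theory Submission
  imports Defs
begin

text \<open>Whatever the decisions, the cost of referring \<open>N\<close> is at least
  \<open>\<Sum>k\<in>{1..K}. Gamma_a_star C (p k)\<close> minus the sum of the referral indices over \<open>N\<close>, with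
  equality for the optimal decisions. The first term does not depend on \<open>N\<close>, and an exchange
  argument shows that the second is largest on a top set.\<close>

text \<open>Greedy induction on \<open>w\<close>: a maximizer \<open>m\<close> of \<open>f\<close>
  on \<open>A - N\<close> is added to a top set \<open>N\<close>. The old elements dominate all of
  \<open>A - N\<close>, and \<open>m\<close> dominates what remains. In the theorem this ensures
  that the optimality claim is not vacuous.\<close>

lemma is_top_set_exists:
  assumes "finite A" "w \<le> card A"
  shows "\<exists>N. is_top_set f A w N"
  using assms(2)
proof (induction w)
  case 0
  show ?case by (intro exI[of _ "{}"]) (simp add: is_top_set_def)
next
  case (Suc w)
  then obtain N where N: "N \<subseteq> A" "card N = w" "\<forall>i\<in>N. \<forall>j\<in>A - N. f j \<le> f i"
    by (auto simp: is_top_set_def)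
  have "A - N \<noteq> {}"
    using N(1,2) Suc.prems by auto
  then obtain m where m: "m \<in> A - N" "\<forall>j\<in>A - N. f j \<le> f m"
    using assms(1) Max_in[of "f ` (A - N)"] Max_ge[of "f ` (A - N)"] by fastforce
  have "finite N"
    using N(1) assms(1) by (rule finite_subset)
  then have "is_top_set f A (Suc w) (insert m N)"
    using N m by (auto simp: is_top_set_def)
  then show ?case ..
qed

lemma sum_le_sum_top_set:
  assumes "finite A" "is_top_set f A w N" "M \<subseteq> A" "card M = w"
  shows "sum f M \<le> sum f N"
proof -
  have N: "N \<subseteq> A" "card N = w" "\<forall>i\<in>N. \<forall>j\<in>A - N. f j \<le> f i"
    using assms(2) by (auto simp: is_top_set_def)
  have fin: "finite M" "finite N"
    using assms(1,3) N(1) by (auto intro: finite_subset)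
  have "card (M - N) = card (N - M)"
    using fin N(2) assms(4) by (simp add: card_Diff_subset_Int Int_commute)
  then obtain h where h: "bij_betw h (M - N) (N - M)"
    using fin finite_same_card_bij[of "M - N" "N - M"] by blast
  \<comment> \<open>Each \<open>x\<close> in \<open>M - N\<close> lies in \<open>A - N\<close>,
    while \<open>h x\<close> lies in \<open>N\<close>, so the top set property bounds
    \<open>f x\<close> by \<open>f (h x)\<close>. The common part of \<open>M\<close> and
    \<open>N\<close> cancels at the end.\<close>
  have "sum f (M - N) \<le> (\<Sum>x\<in>M - N. f (h x))"
    using N(3) assms(3) bij_betw_apply[OF h] by (intro sum_mono) blast
  also have "\<dots> = sum f (N - M)"
    by (rule sum.reindex_bij_betw[OF h])
  finally show ?thesis
    using sum.Int_Diff[of M f N] sum.Int_Diff[of N f M] fin by (simp add: Int_commute)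
qed

lemma Gamma_a_star_le: "Gamma_a_star C p \<le> Gamma_a C p D"
  by (cases D) (simp_all add: Gamma_a_star_def)

text \<open>For a referred task, \<open>Gamma_a_star\<close> minus the index is exactly
  \<open>Gamma_h\<close>; the other tasks keep their \<open>Gamma_a_star\<close>.\<close>

lemma sum_Gamma_a_star_minus_referral_index:
  fixes K :: nat
  assumes "N \<subseteq> {1..K}"
  shows "(\<Sum>k\<in>{1..K}. Gamma_a_star C (p k))
      - (\<Sum>n\<in>N. referral_index C cr Ptp Pfp (p n) (card N))
    = (\<Sum>k\<in>{1..K} - N. Gamma_a_star C (p k))
      + (\<Sum>n\<in>N. Gamma_h C cr Ptp Pfp (p n) (card N))"
  using sum.subset_diff[OF assms finite_atLeastAtMost, of "\<lambda>k. Gamma_a_star C (p k)"]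
  by (simp add: referral_index_def sum_subtractf)

lemma total_cost_ge:
  assumes "N \<subseteq> {1..K}"
  shows "(\<Sum>k\<in>{1..K}. Gamma_a_star C (p k))
      - (\<Sum>n\<in>N. referral_index C cr Ptp Pfp (p n) (card N))
    \<le> total_cost C cr Ptp Pfp K N D p"
  unfolding sum_Gamma_a_star_minus_referral_index[OF assms] total_cost_def
  by (intro add_right_mono sum_mono Gamma_a_star_le)

lemma total_cost_optimal_decisions:
  assumes "N \<subseteq> {1..K}"
    and "\<forall>k\<in>{1..K} - N.
      D k = (if Gamma_a C (p k) H0 \<le> Gamma_a C (p k) H1 then H0 else H1)"
  shows "total_cost C cr Ptp Pfp K N D p
    = (\<Sum>k\<in>{1..K}. Gamma_a_star C (p k))
      - (\<Sum>n\<in>N. referral_index C cr Ptp Pfp (p n) (card N))"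
proof -
  have "(\<Sum>k\<in>{1..K} - N. Gamma_a C (p k) (D k)) = (\<Sum>k\<in>{1..K} - N. Gamma_a_star C (p k))"
    \<comment> \<open>The rule attains the minimum, and its tie-breaking towards \<open>H0\<close>
      agrees with \<open>min_def\<close>.\<close>
    using assms(2) by (intro sum.cong) (simp_all add: Gamma_a_star_def min_def)
  then show ?thesis
    unfolding sum_Gamma_a_star_minus_referral_index[OF assms(1)] total_cost_def by simp
qed

theorem theorem1:
  fixes K w :: nat and W :: "nat set"
    and C :: costs and cr :: real
    and Ptp Pfp :: "nat \<Rightarrow> real"
    and p :: "nat \<Rightarrow> real"
  assumes "K \<ge> 1"
    and "W \<subseteq> {0..K}"
    and "Ptp \<in> W \<rightarrow> {0..1}" and "Pfp \<in> W \<rightarrow> {0..1}"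
    and "p \<in> {1..K} \<rightarrow> {0..1}"
    and "w \<in> W"
  shows "(\<exists>N. is_top_set (\<lambda>k. referral_index C cr Ptp Pfp (p k) w) {1..K} w N) \<and>
    (\<forall>N D. is_top_set (\<lambda>k. referral_index C cr Ptp Pfp (p k) w) {1..K} w N \<longrightarrow>
       (\<forall>k\<in>{1..K} - N.
          D k = (if Gamma_a C (p k) H0 \<le> Gamma_a C (p k) H1 then H0 else H1)) \<longrightarrow>
       is_arg_min (\<lambda>(N, D). total_cost C cr Ptp Pfp K N D p)
         (\<lambda>(N, D). N \<subseteq> {1..K} \<and> card N = w) (N, D))"
proof (intro conjI allI impI)
  let ?R = "\<lambda>k. referral_index C cr Ptp Pfp (p k) w"
  show "\<exists>N. is_top_set ?R {1..K} w N"
    using assms(2,6) by (intro is_top_set_exists) auto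
  fix N D
  assume top: "is_top_set ?R {1..K} w N"
    and D: "\<forall>k\<in>{1..K} - N.
      D k = (if Gamma_a C (p k) H0 \<le> Gamma_a C (p k) H1 then H0 else H1)"
  have N: "N \<subseteq> {1..K}" "card N = w"
    using top by (auto simp: is_top_set_def)
  \<comment> \<open>Since \<open>card M = card N = w\<close>, both index sums are sums of the same
    function \<open>?R\<close>, so the exchange bound compares them.\<close>
  have "total_cost C cr Ptp Pfp K N D p \<le> total_cost C cr Ptp Pfp K M E p"
    if M: "M \<subseteq> {1..K}" "card M = w" for M E
    using total_cost_optimal_decisions[OF N(1) D, of cr Ptp Pfp]
      total_cost_ge[OF M(1), of C p cr Ptp Pfp E] sum_le_sum_top_set[OF _ top M] N(2) M(2)
    by simp
  then show "is_arg_min (\<lambda>(N, D). total_cost C cr Ptp Pfp K N D p)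
      (\<lambda>(N, D). N \<subseteq> {1..K} \<and> card N = w) (N, D)"
    using N by (auto simp: is_arg_min_linorder)
qed

end
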